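(* Let $F=\langle Tree,\unlhd,Choice,R,R_e\rangle$ be a jstit frame for $Ag$. For every constant specification $\mathcal{CS}$, the following are equivalent: (i) for every $\mathcal{CS}$-normal jstit model $\mathcal{M}$ for $Ag$ based on $F$, every formula $A\in Form^{Ag}$ with $\vdash_{\mathcal{CS}}A$ satisfies $\mathcal{M}\models A$; (ii) $F$ is regular, i.e. $F\in\mathcal{F}^{Ag}_{reg}$.
   Context: Language. $Ag$ is a fixed finite set (agents). $PVar$ (proof variables $x,y,z,\dots$), $PConst$ (proof constants $c,d,\dots$) and $Var$ (propositional variables $p,q,\dots$) are countably infinite; all these sets are pairwise disjoint. Proof polynomials $Pol$: $t:=x\mid c\mid s+t\mid s\times t\mid\, !t$. Formulas $Form^{Ag}$: $A:=p\mid A\wedge B\mid\neg A\mid[j]A\mid\Box A\mid t{:}A\mid KA\mid Et$ with $p\in Var$, $j\in Ag$, $t\in Pol$. Other Boolean connectives are the usual abbreviations; $\Diamond=\neg\Box\neg$. Frames. Let $Tree\neq\emptyset$ (moments) and let $\unlhd$ be a partial order on $Tree$ with irreflexive part $\lhd$. $Hist$ is the set of maximal $\unlhd$-chains (histories); $H_m=\{h\in Hist\mid m\in h\}$; $MH=\{(m,h)\mid m\in Tree,h\in H_m\}$. For $h,g\in H_m$, $h\approx_m g$ iff there is $m'\rhd m$ with $h,g\in H_{m'}$. $Next(m,m')$ means $m\lhd m'$ and $(\forall m''\lhd m')(m''\unlhd m)$. $\langle Tree,\unlhd\rangle$ is a temporal frame if: (1) $\forall m,m_1\exists m_2(m_2\unlhd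 m\wedge m_2\unlhd m_1)$; (2) $\forall m,m_1,m_2((m_1\unlhd m\wedge m_2\unlhd m)\Rightarrow(m_1\unlhd m_2\vee m_2\unlhd m_1))$. $\langle Tree,\unlhd,Choice\rangle$ is a stit frame for $Ag$ if moreover $Choice$ assigns to each $m\in Tree$, $j\in Ag$ a partition $Choice^m_j$ of $H_m$ ($Choice^m_j(h)$ is the cell containing $h$) such that (3) $h\approx_m h'$ implies $Choice^m_j(h)=Choice^m_j(h')$; (4) for every $m$ and every function $f$ on $Ag$ with $f(j)\in Choice^m_j$ for all $j$, $\bigcap_{j\in Ag}f(j)\neq\emptyset$. $\langle Tree,\unlhd,Choice,R,R_e\rangle$ is a jstit frame for $Ag$ if moreover $R,R_e$ are pre-orders on $Tree$ with $\unlhd\subseteq R\subseteq R_e$. (Equivalently, these frames are the corresponding reducts of the jstit models defined next.) Models. A jstit model for $Ag$ is $\mathcal{M}=\langle Tree,\unlhd,Choice,Act,R,R_e,\mathcal{E},V\rangle$ where $\langle Tree,\unlhd,Choice,R,R_e\rangle$ is a jstit frame for $Ag$, $Act:MH\to2^{Pol}$, $\mathcal{E}:Tree\times Pol\to2^{Form^{Ag}}$, $V:Var\to2^{MH}$, and, writing $Act_m=\bigcap_{h\in H_m}Act(m,h)$: - $R_e(m,m')\Rightarrow\mathcal{E}(m,t)\subseteq\mathcal{E}(m',t)$; - if $A\to B\in\mathcal{E}(m,s)$ and $A\in\mathcal{E}(m,t)$ then $B\in\mathcal{E}(m,s\times t)$; $\mathcal{E}(m,s)\cup\mathcal{E}(m,t)\subseteq\mathcal{E}(m,s+t)$;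 $A\in\mathcal{E}(m,t)\Rightarrow t{:}A\in\mathcal{E}(m,!t)$; - $m'\lhd m\Rightarrow\forall h\in H_m\,(Act(m',h)\subseteq Act(m,h))$; - $Act_m\subseteq\bigcup_{m'\lhd m,\,h\in H_m}Act(m',h)$; - for $h,h'\in H_m$: $h\approx_m h'\Rightarrow Act(m,h)=Act(m,h')$; - $R_e(m,m')\Rightarrow Act_m\subseteq Act_{m'}$. A model is based on each of its frame reducts (jstit, stit, temporal). Satisfaction at $(m,h)\in MH$: $p$ iff $(m,h)\in V(p)$; standard Boolean clauses; $[j]A$ iff $\mathcal{M},m,h'\models A$ for all $h'\in Choice^m_j(h)$; $\Box A$ iff $\mathcal{M},m,h'\models A$ for all $h'\in H_m$; $KA$ iff $\mathcal{M},m',h'\models A$ whenever $R(m,m')$ and $h'\in H_{m'}$; $t{:}A$ iff $A\in\mathcal{E}(m,t)$ and $\mathcal{M},m',h'\models A$ whenever $R_e(m,m')$ and $h'\in H_{m'}$; $Et$ iff $t\in Act(m,h)$. $\mathcal{M}\models A$ means $\mathcal{M},m,h\models A$ for all $(m,h)\in MH$. Axiom schemes: (A0) classical propositional axioms; (A1) S5 axioms for $\Box$ and each $[j]$; (A2) $\Box A\to[j]A$; (A3) $(\Diamond[j_1]A_1\wedge\dots\wedge\Diamond[j_n]A_n)\to\Diamond([j_1]A_1\wedge\dots\wedge[j_n]A_n)$ for pairwise different $j_1,\dots,j_n$; (A4) $s{:}(A\to B)\to(t{:}A\to(s\times t){:}B)$; (A5) $t{:}A\to(!t{:}(t{:}A)\wedge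 KA)$; (A6) $(s{:}A\vee t{:}A)\to(s+t){:}A$; (A7) S4 axioms for $K$; (A8) $KA\to\Box K\Box A$; (A9) $\Box Et\to K\Box Et$. A constant specification is a set $\mathcal{CS}\subseteq\{c_n{:}\dots c_1{:}A\mid c_1,\dots,c_n\in PConst,\ A\text{ an instance of (A0)--(A9)}\}$ such that $c_{n+1}{:}c_n{:}\dots c_1{:}A\in\mathcal{CS}$ implies $c_n{:}\dots c_1{:}A\in\mathcal{CS}$. A jstit model is $\mathcal{CS}$-normal iff $\{A\mid c{:}A\in\mathcal{CS}\}\subseteq\mathcal{E}(m,c)$ for all $c\in PConst$, $m\in Tree$. System $\Sigma_D(\mathcal{CS})$: axioms (A0)--(A9) and rules (R1) from $A$, $A\to B$ infer $B$; (R2) from $A$ infer $KA$; ($R_D$) from $KA\to(\neg\Box Et_1\vee\dots\vee\neg\Box Et_n\vee\Box Es_1\vee\dots\vee\Box Es_k)$ infer $KA\to(\neg Et_1\vee\dots\vee\neg Et_n\vee Es_1\vee\dots\vee Es_k)$, where $n,k\geq0$; ($R_{\mathcal{CS}}$) infer any member of $\mathcal{CS}$. $\vdash_{\mathcal{CS}}A$ means $A$ is provable in $\Sigma_D(\mathcal{CS})$ (there is a finite sequence ending in $A$, each member of which is an axiom or obtained by a rule from earlier members). Regularity. For a jstit frame $F$ and $m\in Tree$, $\Theta_m$ is the set of all $S\subseteq Tree$ such that: (1) $m\in S$; (2) for all $m_1,m_2$: if $m_1\in S$ and $R_e(m_1,m_2)$ then $m_2\in S$; (3) for all $m_1$: if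 $(\forall h\in H_{m_1})(\exists m_2\in h)(Next(m_1,m_2)\wedge m_2\in S)$ then $m_1\in S$; (4) for all $m_1$: if $m_1\in S$ and $(\forall m_2\lhd m_1)\exists m_3(m_2\lhd m_3\lhd m_1)$ then $(\exists m_4\lhd m_1)(m_4\in S)$. $F$ is regular iff for all $m,m_1\in Tree$: if $m\lhd m_1$ and there is $S\in\bigcap_{m\lhd m_0\unlhd m_1}\Theta_{m_0}$ such that $m\notin S$ and there is $h'\in H_m$ with $(\forall g\in H_{m_1})(h'\not\approx_m g)$ and $(\forall m'\in h')(Next(m,m')\Rightarrow m'\notin S)$, then $(\exists m_2\unlhd m_1)Next(m,m_2)$. $\mathcal{F}^{Ag}_{reg}$ is the class of regular jstit frames for $Ag$. *)

theory Defs
  imports Main "HOL-Library.Disjoint_Sets"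
begin

section \<open>Language\<close>

text \<open>The three countably infinite sets of variables and constants are disjoint copies of
  the natural numbers.\<close>

datatype pol =
    PVar nat
  | PConst nat
  | Sum pol pol
  | App pol pol
  | Check pol

datatype (agents: 'ag) form =
    Var nat
  | And "'ag form" "'ag form"
  | Neg "'ag form"
  | Stit 'ag "'ag form"
  | Box "'ag form"
  | Just pol "'ag form"
  | Know "'ag form"
  | Ev pol

definition Form :: "'ag set \<Rightarrow> 'ag form set" where
  "Form Ag = {A. agents A \<subseteq> Ag}"

abbreviation Or :: "'ag form \<Rightarrow> 'ag form \<Rightarrow> 'ag form" where
  "Or A B \<equiv> Neg (And (Neg A) (Neg B))"

abbreviation Imp :: "'ag form \<Rightarrow> 'ag form \<Rightarrow> 'ag form" where
  "Imp A B \<equiv> Neg (And A (Neg B))"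

abbreviation Dia :: "'ag form \<Rightarrow> 'ag form" where
  "Dia A \<equiv> Neg (Box (Neg A))"

abbreviation Falsum :: "'ag form" where
  "Falsum \<equiv> And (Var 0) (Neg (Var 0))"

text \<open>Finite conjunctions and disjunctions associate to the right and have no trailing unit;
  the empty disjunction is falsum.\<close>

fun big_and :: "'ag form list \<Rightarrow> 'ag form" where
  "big_and [] = Neg Falsum"
| "big_and [A] = A"
| "big_and (A # B # As) = And A (big_and (B # As))"

fun big_or :: "'ag form list \<Rightarrow> 'ag form" where
  "big_or [] = Falsum"
| "big_or [A] = A"
| "big_or (A # B # As) = Or A (big_or (B # As))"

section \<open>Frames\<close>

text \<open>The set of moments is the (nonempty) type \<open>'m\<close>.\<close>

record ('m, 'ag) jstit_frame =
  le :: "'m \<Rightarrow> 'm \<Rightarrow> bool"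
  choice :: "'m \<Rightarrow> 'ag \<Rightarrow> 'm set set set"
  Rel :: "'m \<Rightarrow> 'm \<Rightarrow> bool"
  Rel_e :: "'m \<Rightarrow> 'm \<Rightarrow> bool"

definition lt :: "('m, 'ag, 'z) jstit_frame_scheme \<Rightarrow> 'm \<Rightarrow> 'm \<Rightarrow> bool" where
  "lt F m m' \<longleftrightarrow> le F m m' \<and> m \<noteq> m'"

definition Hist :: "('m, 'ag, 'z) jstit_frame_scheme \<Rightarrow> 'm set set" where
  "Hist F = {h. pred_on.maxchain UNIV (le F) h}"

definition Hist_at :: "('m, 'ag, 'z) jstit_frame_scheme \<Rightarrow> 'm \<Rightarrow> 'm set set" where
  "Hist_at F m = {h \<in> Hist F. m \<in> h}"

definition MH :: "('m, 'ag, 'z) jstit_frame_scheme \<Rightarrow> ('m \<times> 'm set) set" where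
  "MH F = {(m, h). h \<in> Hist_at F m}"

definition undivided :: "('m, 'ag, 'z) jstit_frame_scheme \<Rightarrow> 'm \<Rightarrow> 'm set \<Rightarrow> 'm set \<Rightarrow> bool" where
  "undivided F m h g \<longleftrightarrow> (\<exists>m'. lt F m m' \<and> h \<in> Hist_at F m' \<and> g \<in> Hist_at F m')"

definition Next :: "('m, 'ag, 'z) jstit_frame_scheme \<Rightarrow> 'm \<Rightarrow> 'm \<Rightarrow> bool" where
  "Next F m m' \<longleftrightarrow> lt F m m' \<and> (\<forall>m''. lt F m'' m' \<longrightarrow> le F m'' m)"

definition cell :: "('m, 'ag, 'z) jstit_frame_scheme \<Rightarrow> 'm \<Rightarrow> 'ag \<Rightarrow> 'm set \<Rightarrow> 'm set set" where
  "cell F m j h = (THE c. c \<in> choice F m j \<and> h \<in> c)"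

definition temporal_frame :: "('m, 'ag, 'z) jstit_frame_scheme \<Rightarrow> bool" where
  "temporal_frame F \<longleftrightarrow>
     reflp (le F) \<and> antisymp (le F) \<and> transp (le F) \<and>
     (\<forall>m m1. \<exists>m2. le F m2 m \<and> le F m2 m1) \<and>
     (\<forall>m m1 m2. le F m1 m \<and> le F m2 m \<longrightarrow> le F m1 m2 \<or> le F m2 m1)"

definition stit_frame :: "'ag set \<Rightarrow> ('m, 'ag, 'z) jstit_frame_scheme \<Rightarrow> bool" where
  "stit_frame Ag F \<longleftrightarrow>
     temporal_frame F \<and>
     (\<forall>m. \<forall>j\<in>Ag. partition_on (Hist_at F m) (choice F m j)) \<and>
     (\<forall>m. \<forall>j\<in>Ag. \<forall>h\<in>Hist_at F m. \<forall>h'\<in>Hist_at F m.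
        undivided F m h h' \<longrightarrow> cell F m j h = cell F m j h') \<and>
     (\<forall>m f. (\<forall>j\<in>Ag. f j \<in> choice F m j) \<longrightarrow> (\<Inter>j\<in>Ag. f j) \<noteq> {})"

definition jstit_frame :: "'ag set \<Rightarrow> ('m, 'ag, 'z) jstit_frame_scheme \<Rightarrow> bool" where
  "jstit_frame Ag F \<longleftrightarrow>
     stit_frame Ag F \<and>
     reflp (Rel F) \<and> transp (Rel F) \<and>
     reflp (Rel_e F) \<and> transp (Rel_e F) \<and>
     le F \<le> Rel F \<and> Rel F \<le> Rel_e F"

section \<open>Models\<close>

record ('m, 'ag) jstit_model = "('m, 'ag) jstit_frame" +
  Act :: "'m \<Rightarrow> 'm set \<Rightarrow> pol set"
  Evid :: "'m \<Rightarrow> pol \<Rightarrow> 'ag form set"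
  Val :: "nat \<Rightarrow> ('m \<times> 'm set) set"

definition Act_at :: "('m, 'ag, 'z) jstit_model_scheme \<Rightarrow> 'm \<Rightarrow> pol set" where
  "Act_at M m = (\<Inter>h\<in>Hist_at M m. Act M m h)"

text \<open>Only the values of \<open>Act\<close> at moment-history pairs are ever used; its values elsewhere
  are junk.\<close>

definition jstit_model :: "'ag set \<Rightarrow> ('m, 'ag) jstit_model \<Rightarrow> bool" where
  "jstit_model Ag M \<longleftrightarrow>
     jstit_frame Ag M \<and>
     (\<forall>m t. Evid M m t \<subseteq> Form Ag) \<and>
     (\<forall>p. Val M p \<subseteq> MH M) \<and>
     (\<forall>m m' t. Rel_e M m m' \<longrightarrow> Evid M m t \<subseteq> Evid M m' t) \<and>
     (\<forall>m s t A B. Imp A B \<in> Evid M m s \<and> A \<in> Evid M m t \<longrightarrow> B \<in> Evid M m (App s t)) \<and>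
     (\<forall>m s t. Evid M m s \<union> Evid M m t \<subseteq> Evid M m (Sum s t)) \<and>
     (\<forall>m t A. A \<in> Evid M m t \<longrightarrow> Just t A \<in> Evid M m (Check t)) \<and>
     (\<forall>m m'. lt M m' m \<longrightarrow> (\<forall>h\<in>Hist_at M m. Act M m' h \<subseteq> Act M m h)) \<and>
     (\<forall>m. Act_at M m \<subseteq> (\<Union>m'\<in>{m'. lt M m' m}. \<Union>h\<in>Hist_at M m. Act M m' h)) \<and>
     (\<forall>m. \<forall>h\<in>Hist_at M m. \<forall>h'\<in>Hist_at M m.
        undivided M m h h' \<longrightarrow> Act M m h = Act M m h') \<and>
     (\<forall>m m'. Rel_e M m m' \<longrightarrow> Act_at M m \<subseteq> Act_at M m')"

definition based_on :: "('m, 'ag) jstit_model \<Rightarrow> ('m, 'ag) jstit_frame \<Rightarrow> bool" where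
  "based_on M F \<longleftrightarrow> jstit_frame.truncate M = F"

primrec sat :: "('m, 'ag) jstit_model \<Rightarrow> 'm \<Rightarrow> 'm set \<Rightarrow> 'ag form \<Rightarrow> bool" where
  "sat M m h (Var p) \<longleftrightarrow> (m, h) \<in> Val M p"
| "sat M m h (And A B) \<longleftrightarrow> sat M m h A \<and> sat M m h B"
| "sat M m h (Neg A) \<longleftrightarrow> \<not> sat M m h A"
| "sat M m h (Stit j A) \<longleftrightarrow> (\<forall>h'\<in>cell M m j h. sat M m h' A)"
| "sat M m h (Box A) \<longleftrightarrow> (\<forall>h'\<in>Hist_at M m. sat M m h' A)"
| "sat M m h (Just t A) \<longleftrightarrow>
     A \<in> Evid M m t \<and> (\<forall>m'. Rel_e M m m' \<longrightarrow> (\<forall>h'\<in>Hist_at M m'. sat M m' h' A))"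
| "sat M m h (Know A) \<longleftrightarrow> (\<forall>m'. Rel M m m' \<longrightarrow> (\<forall>h'\<in>Hist_at M m'. sat M m' h' A))"
| "sat M m h (Ev t) \<longleftrightarrow> t \<in> Act M m h"

definition valid_in :: "('m, 'ag) jstit_model \<Rightarrow> 'ag form \<Rightarrow> bool" where
  "valid_in M A \<longleftrightarrow> (\<forall>(m, h)\<in>MH M. sat M m h A)"

section \<open>Axioms, constant specifications, provability\<close>

text \<open>As classical propositional axioms we take all instances of classical tautologies, that is,
  all formulas true under every Boolean valuation of their non-Boolean subformulas.\<close>

primrec peval :: "('ag form \<Rightarrow> bool) \<Rightarrow> 'ag form \<Rightarrow> bool" where
  "peval v (Var p) \<longleftrightarrow> v (Var p)"
| "peval v (And A B) \<longleftrightarrow> peval v A \<and> peval v B"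
| "peval v (Neg A) \<longleftrightarrow> \<not> peval v A"
| "peval v (Stit j A) \<longleftrightarrow> v (Stit j A)"
| "peval v (Box A) \<longleftrightarrow> v (Box A)"
| "peval v (Just t A) \<longleftrightarrow> v (Just t A)"
| "peval v (Know A) \<longleftrightarrow> v (Know A)"
| "peval v (Ev t) \<longleftrightarrow> v (Ev t)"

definition tautology :: "'ag form \<Rightarrow> bool" where
  "tautology A \<longleftrightarrow> (\<forall>v. peval v A)"

inductive S4_axiom :: "('ag form \<Rightarrow> 'ag form) \<Rightarrow> 'ag form \<Rightarrow> bool" for N where
  K: "S4_axiom N (Imp (N (Imp A B)) (Imp (N A) (N B)))"
| T: "S4_axiom N (Imp (N A) A)"
| Four: "S4_axiom N (Imp (N A) (N (N A)))"

inductive S5_axiom :: "('ag form \<Rightarrow> 'ag form) \<Rightarrow> 'ag form \<Rightarrow> bool" for N where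
  S4: "S4_axiom N A \<Longrightarrow> S5_axiom N A"
| Five: "S5_axiom N (Imp (Neg (N A)) (N (Neg (N A))))"

inductive axiom_scheme :: "'ag form \<Rightarrow> bool" where
  A0: "tautology A \<Longrightarrow> axiom_scheme A"
| A1_Box: "S5_axiom Box A \<Longrightarrow> axiom_scheme A"
| A1_Stit: "S5_axiom (Stit j) A \<Longrightarrow> axiom_scheme A"
| A2: "axiom_scheme (Imp (Box A) (Stit j A))"
| A3: "ps \<noteq> [] \<Longrightarrow> distinct (map fst ps) \<Longrightarrow>
    axiom_scheme (Imp (big_and (map (\<lambda>(j, A). Dia (Stit j A)) ps))
                      (Dia (big_and (map (\<lambda>(j, A). Stit j A) ps))))"
| A4: "axiom_scheme (Imp (Just s (Imp A B)) (Imp (Just t A) (Just (App s t) B)))"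
| A5: "axiom_scheme (Imp (Just t A) (And (Just (Check t) (Just t A)) (Know A)))"
| A6: "axiom_scheme (Imp (Or (Just s A) (Just t A)) (Just (Sum s t) A))"
| A7: "S4_axiom Know A \<Longrightarrow> axiom_scheme A"
| A8: "axiom_scheme (Imp (Know A) (Box (Know (Box A))))"
| A9: "axiom_scheme (Imp (Box (Ev t)) (Know (Box (Ev t))))"

definition axioms :: "'ag set \<Rightarrow> 'ag form set" where
  "axioms Ag = {A \<in> Form Ag. axiom_scheme A}"

text \<open>\<open>const_prefix [c\<^sub>n, \<dots>, c\<^sub>1] A\<close> is the formula \<open>c\<^sub>n:\<dots>c\<^sub>1:A\<close>.\<close>

definition const_prefix :: "nat list \<Rightarrow> 'ag form \<Rightarrow> 'ag form" where
  "const_prefix cs A = foldr (\<lambda>c B. Just (PConst c) B) cs A"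

definition constant_specification :: "'ag set \<Rightarrow> 'ag form set \<Rightarrow> bool" where
  "constant_specification Ag CS \<longleftrightarrow>
     CS \<subseteq> {const_prefix cs A | cs A. cs \<noteq> [] \<and> A \<in> axioms Ag} \<and>
     (\<forall>c cs A. cs \<noteq> [] \<and> A \<in> axioms Ag \<and> const_prefix (c # cs) A \<in> CS \<longrightarrow>
        const_prefix cs A \<in> CS)"

definition CS_normal :: "'ag form set \<Rightarrow> ('m, 'ag) jstit_model \<Rightarrow> bool" where
  "CS_normal CS M \<longleftrightarrow> (\<forall>c m. {A. Just (PConst c) A \<in> CS} \<subseteq> Evid M m (PConst c))"

inductive provable :: "'ag set \<Rightarrow> 'ag form set \<Rightarrow> 'ag form \<Rightarrow> bool" for Ag CS where
  Ax: "A \<in> axioms Ag \<Longrightarrow> provable Ag CS A"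
| R1: "provable Ag CS A \<Longrightarrow> provable Ag CS (Imp A B) \<Longrightarrow> provable Ag CS B"
| R2: "provable Ag CS A \<Longrightarrow> provable Ag CS (Know A)"
| R_D: "provable Ag CS
          (Imp (Know A) (big_or (map (\<lambda>t. Neg (Box (Ev t))) ts @ map (\<lambda>s. Box (Ev s)) ss)))
        \<Longrightarrow> provable Ag CS
          (Imp (Know A) (big_or (map (\<lambda>t. Neg (Ev t)) ts @ map (\<lambda>s. Ev s) ss)))"
| R_CS: "A \<in> CS \<Longrightarrow> provable Ag CS A"

section \<open>Regularity\<close>

definition Theta :: "('m, 'ag, 'z) jstit_frame_scheme \<Rightarrow> 'm \<Rightarrow> 'm set set" where
  "Theta F m = {S.
     m \<in> S \<and>
     (\<forall>m1 m2. m1 \<in> S \<and> Rel_e F m1 m2 \<longrightarrow> m2 \<in> S) \<and>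
     (\<forall>m1. (\<forall>h\<in>Hist_at F m1. \<exists>m2\<in>h. Next F m1 m2 \<and> m2 \<in> S) \<longrightarrow> m1 \<in> S) \<and>
     (\<forall>m1. m1 \<in> S \<and> (\<forall>m2. lt F m2 m1 \<longrightarrow> (\<exists>m3. lt F m2 m3 \<and> lt F m3 m1))
        \<longrightarrow> (\<exists>m4. lt F m4 m1 \<and> m4 \<in> S))}"

definition regular :: "('m, 'ag, 'z) jstit_frame_scheme \<Rightarrow> bool" where
  "regular F \<longleftrightarrow> (\<forall>m m1.
     lt F m m1 \<and>
     (\<exists>S \<in> (\<Inter>m0\<in>{m0. lt F m m0 \<and> le F m0 m1}. Theta F m0).
        m \<notin> S \<and>
        (\<exists>h'\<in>Hist_at F m.
           (\<forall>g\<in>Hist_at F m1. \<not> undivided F m h' g) \<and>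
           (\<forall>m'\<in>h'. Next F m m' \<longrightarrow> m' \<notin> S)))
     \<longrightarrow> (\<exists>m2. le F m2 m1 \<and> Next F m m2))"

definition regular_frames :: "'ag set \<Rightarrow> ('m, 'ag) jstit_frame set" where
  "regular_frames Ag = {F. jstit_frame Ag F \<and> regular F}"

end

theory Submission
  imports Defs
begin

text \<open>Say that a proof \<open>t\<close> is \<^emph>\<open>settled\<close> at \<open>n\<close> if it is presented along every history through \<open>n\<close>,
  that is, if \<open>\<box>Et\<close> holds there. In every model on a frame, the set of moments at which a given finite
  nonempty set of proofs is settled satisfies the closure conditions that define \<open>\<Theta>\<close>
  (\<open>settled_moments_in_Theta\<close>), and conversely each member of \<open>\<Theta>\<close> can be realised as such a set.
  Regularity says how these sets may behave right after a moment where histories divide, and this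
  is what the rule \<open>R\<^sub>D\<close> exploits: its premise speaks of settled proofs, its conclusion of
  presented ones.

  All axioms and all other rules are sound on every jstit frame, so soundness on a regular frame
  comes down to \<open>R\<^sub>D\<close> (\<open>R_D_sound\<close>). Suppose its conclusion fails at \<open>(m, h)\<close>: all proofs in \<open>ts\<close>
  and none in \<open>ss\<close> are presented there. Then a history \<open>g\<close>, on which one of the proofs \<open>ts\<close> is
  missing, divides from \<open>h\<close> at \<open>m\<close>, while throughout \<open>h\<close> after \<open>m\<close> the proofs \<open>ts\<close> and a single \<open>s\<close> from \<open>ss\<close> are settled. Regularity then
  gives \<open>m\<close> an immediate successor on \<open>h\<close>. What is settled at an immediate successor was
  presented at its predecessor, so \<open>s\<close> is presented at \<open>(m, h)\<close> after all.

  On an irregular frame, a set \<open>S\<close> that violates regularity at \<open>m\<close> and \<open>m1\<close> yields a model in which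
  two proof variables are settled exactly on \<open>S\<close>, one of them being presented somewhat earlier than
  the other: already at \<open>m\<close>, on the histories that stay together with those through \<open>m1\<close>
  (\<open>countermodel_is_model\<close>). The missing immediate successor of \<open>m\<close> is what allows the other proof
  to be absent there. Evidence is total in this model, hence it is normal for every constant
  specification, and it refutes a formula that \<open>R\<^sub>D\<close> derives from an instance of \<open>KA \<rightarrow> A\<close>
  (\<open>provable_settled_to_presented\<close>).\<close>

section \<open>Histories of a temporal frame\<close>

lemma temporal_le:
  assumes "temporal_frame F"
  shows le_refl: "le F x x"
    and le_antisym: "le F x y \<Longrightarrow> le F y x \<Longrightarrow> x = y"
    and le_trans: "le F x y \<Longrightarrow> le F y z \<Longrightarrow> le F x z"
    and le_linear_below: "le F x z \<Longrightarrow> le F y z \<Longrightarrow> le F x y \<or> le F y x"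
  using assms unfolding temporal_frame_def
  by (auto dest: reflpD antisympD transpD)

lemma lt_imp_le: "lt F x y \<Longrightarrow> le F x y"
  by (simp add: lt_def)

lemma history_comparable:
  assumes "temporal_frame F" "h \<in> Hist F" "x \<in> h" "y \<in> h"
  shows "le F x y \<or> le F y x"
  using assms le_refl[OF assms(1)]
  unfolding Hist_def pred_on.maxchain_def pred_on.chain_def by auto

lemma history_maximal:
  assumes "temporal_frame F" "h \<in> Hist F" "\<And>x. x \<in> h \<Longrightarrow> le F x y \<or> le F y x"
  shows "y \<in> h"
proof (rule ccontr)
  assume "y \<notin> h"
  moreover have "pred_on.chain UNIV (le F) (insert y h)"
    using assms(3) history_comparable[OF assms(1,2)] unfolding pred_on.chain_def by auto
  ultimately show False
    using assms(2) unfolding Hist_def pred_on.maxchain_def by blast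
qed

lemma history_downward_closed:
  assumes T: "temporal_frame F" and "h \<in> Hist F" "x \<in> h" "le F y x"
  shows "y \<in> h"
  using assms history_maximal[OF T assms(2)] history_comparable[OF T assms(2,3)]
  by (metis le_linear_below[OF T] le_trans[OF T])

lemma Hist_at_downward_closed:
  assumes "temporal_frame F" "h \<in> Hist_at F x" "le F y x"
  shows "h \<in> Hist_at F y"
  using assms history_downward_closed[OF assms(1)] unfolding Hist_at_def by auto

text \<open>A maximal chain among the moments comparable with \<open>m\<close> must contain \<open>m\<close>, and then it is
  maximal among all moments, since every larger chain contains \<open>m\<close> too.\<close>

lemma history_through_moment:
  assumes T: "temporal_frame F"
  shows "\<exists>h. h \<in> Hist_at F m"
proof -
  let ?A = "{x. le F x m \<or> le F m x}"
  obtain C where C: "pred_on.maxchain ?A (le F) C"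
    using pred_on.Hausdorff by blast
  then have chain: "pred_on.chain ?A (le F) C"
    and max: "\<And>D. pred_on.chain ?A (le F) D \<Longrightarrow> \<not> C \<subset> D"
    by (auto simp: pred_on.maxchain_def)
  have "pred_on.chain ?A (le F) (insert m C)"
    using chain le_refl[OF T] unfolding pred_on.chain_def by auto
  then have mC: "m \<in> C"
    using max by blast
  have "pred_on.chain UNIV (le F) C"
    using chain unfolding pred_on.chain_def by auto
  moreover have "\<not> C \<subset> D" if "pred_on.chain UNIV (le F) D" for D
  proof
    assume "C \<subset> D"
    then have "pred_on.chain ?A (le F) D"
      using that mC le_refl[OF T] unfolding pred_on.chain_def by blast
    then show False
      using max \<open>C \<subset> D\<close> by blast
  qed
  ultimately show ?thesis
    using mC unfolding Hist_at_def Hist_def pred_on.maxchain_def by blast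
qed

text \<open>Two histories undivided at \<open>n\<close> share an initial stretch after \<open>n\<close>: the smaller of a common
  later moment and of \<open>x\<close> lies on both.\<close>

lemma undivided_share_moment:
  assumes T: "temporal_frame F" and "undivided F n h g" "lt F n x" "x \<in> h"
  shows "\<exists>y. lt F n y \<and> le F y x \<and> y \<in> h \<and> y \<in> g"
proof -
  obtain z where z: "lt F n z" "h \<in> Hist F" "g \<in> Hist F" "z \<in> h" "z \<in> g"
    using assms(2) unfolding undivided_def Hist_at_def by auto
  consider "le F x z" | "le F z x"
    using history_comparable[OF T z(2) \<open>x \<in> h\<close> z(4)] by blast
  then show ?thesis
    using z assms history_downward_closed[OF T] le_refl[OF T] by cases blast+
qed

lemma Next_share:
  assumes T: "temporal_frame F" and "undivided F n h g" "Next F n x" "x \<in> h"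
  shows "x \<in> g"
proof -
  have "lt F n x" and *: "\<And>y. lt F y x \<Longrightarrow> le F y n"
    using assms(3) unfolding Next_def by auto
  then obtain y where "lt F n y" "le F y x" "y \<in> g"
    using undivided_share_moment[OF assms(1,2)] assms(4) by blast
  then show ?thesis
    using * le_antisym[OF T] unfolding lt_def by metis
qed

lemma Next_least_above:
  assumes T: "temporal_frame F" and "Next F n x" "h \<in> Hist F" "x \<in> h" "y \<in> h" "lt F n y"
  shows "le F x y"
  using history_comparable[OF T assms(3-5)] assms(2,6) le_antisym[OF T] le_refl[OF T]
  unfolding Next_def lt_def by metis

section \<open>Choice cells\<close>

lemma jstit_frame_temporal: "jstit_frame Ag F \<Longrightarrow> temporal_frame F"
  by (simp add: jstit_frame_def stit_frame_def)

lemma jstit_frame_relations: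
  assumes "jstit_frame Ag F"
  shows Rel_refl: "Rel F x x"
    and Rel_trans: "Rel F x y \<Longrightarrow> Rel F y z \<Longrightarrow> Rel F x z"
    and Rel_e_trans: "Rel_e F x y \<Longrightarrow> Rel_e F y z \<Longrightarrow> Rel_e F x z"
    and le_imp_Rel: "le F x y \<Longrightarrow> Rel F x y"
    and Rel_imp_Rel_e: "Rel F x y \<Longrightarrow> Rel_e F x y"
  using assms unfolding jstit_frame_def
  by (auto dest: reflpD transpD)

context
  fixes Ag and F :: "('m, 'ag, 'z) jstit_frame_scheme"
  assumes frame: "jstit_frame Ag F"
begin

lemma choice_partition: "j \<in> Ag \<Longrightarrow> partition_on (Hist_at F m) (choice F m j)"
  using frame by (simp add: jstit_frame_def stit_frame_def)

lemma cell_eqI: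
  assumes "j \<in> Ag" "c \<in> choice F m j" "h \<in> c"
  shows "cell F m j h = c"
  unfolding cell_def
proof (rule the_equality)
  show "c' = c" if "c' \<in> choice F m j \<and> h \<in> c'" for c'
    using that assms partition_onD2[OF choice_partition[OF assms(1)]]
    by (auto simp: disjoint_def)
qed (use assms in simp)

lemma cell_in_choice:
  assumes "j \<in> Ag" "h \<in> Hist_at F m"
  shows "cell F m j h \<in> choice F m j \<and> h \<in> cell F m j h"
proof -
  obtain c where "c \<in> choice F m j" "h \<in> c"
    using partition_onD1[OF choice_partition[OF assms(1)]] assms(2) by blast
  then show ?thesis
    using cell_eqI[OF assms(1)] by simp
qed

lemma cell_subset: "j \<in> Ag \<Longrightarrow> h \<in> Hist_at F m \<Longrightarrow> cell F m j h \<subseteq> Hist_at F m"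
  using cell_in_choice partition_onD1[OF choice_partition] by blast

lemma cell_eq: "j \<in> Ag \<Longrightarrow> h \<in> Hist_at F m \<Longrightarrow> g \<in> cell F m j h \<Longrightarrow> cell F m j g = cell F m j h"
  using cell_in_choice[of j h m] cell_eqI[of j "cell F m j h" m g] by blast

lemma choices_meet:
  assumes "\<And>j. j \<in> Ag \<Longrightarrow> f j \<in> choice F m j"
  shows "\<exists>h. \<forall>j\<in>Ag. h \<in> f j"
proof -
  have "\<forall>f. (\<forall>j\<in>Ag. f j \<in> choice F m j) \<longrightarrow> (\<Inter>j\<in>Ag. f j) \<noteq> {}"
    using frame unfolding jstit_frame_def stit_frame_def by (elim conjE) (rule spec)
  then have "(\<Inter>j\<in>Ag. f j) \<noteq> {}"
    using assms by blast
  then show ?thesis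
    by blast
qed

end

section \<open>Formulas of the language and their Boolean structure\<close>

lemma agents_big_and [simp]: "agents (big_and As) = \<Union> (agents ` set As)"
  by (induction As rule: big_and.induct) auto

lemma sat_big_or [simp]: "sat M m h (big_or As) \<longleftrightarrow> (\<exists>A\<in>set As. sat M m h A)"
  by (induction As rule: big_or.induct) auto

lemma sat_big_and [simp]: "sat M m h (big_and As) \<longleftrightarrow> (\<forall>A\<in>set As. sat M m h A)"
  by (induction As rule: big_and.induct) auto

lemma peval_sat: "peval (sat M m h) A \<longleftrightarrow> sat M m h A"
  by (induction A) auto

lemma agents_const_prefix [simp]: "agents (const_prefix cs A) = agents A"
  by (induction cs) (auto simp: const_prefix_def)

lemma CS_subset_Form:
  assumes "constant_specification Ag CS"
  shows "CS \<subseteq> Form Ag"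
proof
  fix B
  assume "B \<in> CS"
  then obtain cs A where "B = const_prefix cs A" "A \<in> axioms Ag"
    using assms unfolding constant_specification_def by blast
  then show "B \<in> Form Ag"
    by (simp add: axioms_def Form_def)
qed

section \<open>Validity of the axioms\<close>

context
  fixes Ag and M :: "('m, 'ag) jstit_model"
  assumes model: "jstit_model Ag M"
begin

lemma model_frame: "jstit_frame Ag M"
  using model by (simp add: jstit_model_def)

lemma model_temporal: "temporal_frame M"
  using jstit_frame_temporal[OF model_frame] .

lemma model_clauses:
  shows Evid_mono: "Rel_e M n n' \<Longrightarrow> Evid M n t \<subseteq> Evid M n' t"
    and Evid_App: "Imp A B \<in> Evid M n s \<Longrightarrow> A \<in> Evid M n t \<Longrightarrow> B \<in> Evid M n (App s t)"
    and Evid_Sum: "Evid M n s \<union> Evid M n t \<subseteq> Evid M n (Sum s t)"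
    and Evid_Check: "A \<in> Evid M n t \<Longrightarrow> Just t A \<in> Evid M n (Check t)"
    and Act_mono: "lt M n n' \<Longrightarrow> h \<in> Hist_at M n' \<Longrightarrow> Act M n h \<subseteq> Act M n' h"
    and Act_at_earlier: "t \<in> Act_at M n' \<Longrightarrow> \<exists>n h. lt M n n' \<and> h \<in> Hist_at M n' \<and> t \<in> Act M n h"
    and Act_undivided: "h \<in> Hist_at M n \<Longrightarrow> h' \<in> Hist_at M n \<Longrightarrow> undivided M n h h' \<Longrightarrow>
      Act M n h = Act M n h'"
    and Act_at_mono: "Rel_e M n n' \<Longrightarrow> Act_at M n \<subseteq> Act_at M n'"
proof -
  \<comment> \<open>The clauses, in the order of the claims; the frame conditions and the two typing clauses
    precede them.\<close>
  note c1 = model[unfolded jstit_model_def, THEN conjunct2, THEN conjunct2, THEN conjunct2]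
  note c2 = c1[THEN conjunct2]
  note c3 = c2[THEN conjunct2]
  note c4 = c3[THEN conjunct2]
  note c5 = c4[THEN conjunct2]
  note c6 = c5[THEN conjunct2]
  note c7 = c6[THEN conjunct2]
  note c8 = c7[THEN conjunct2]
  show "Evid M n t \<subseteq> Evid M n' t" if "Rel_e M n n'"
    using that c1[THEN conjunct1] by blast
  show "B \<in> Evid M n (App s t)" if "Imp A B \<in> Evid M n s" "A \<in> Evid M n t"
    using that c2[THEN conjunct1] by blast
  show "Evid M n s \<union> Evid M n t \<subseteq> Evid M n (Sum s t)"
    using c3[THEN conjunct1] by blast
  show "Just t A \<in> Evid M n (Check t)" if "A \<in> Evid M n t"
    using that c4[THEN conjunct1] by blast
  show "Act M n h \<subseteq> Act M n' h" if "lt M n n'" "h \<in> Hist_at M n'"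
    using that c5[THEN conjunct1] by blast
  show "\<exists>n h. lt M n n' \<and> h \<in> Hist_at M n' \<and> t \<in> Act M n h" if "t \<in> Act_at M n'"
    using that c6[THEN conjunct1, THEN spec, of n'] by blast
  show "Act M n h = Act M n h'"
    if "h \<in> Hist_at M n" "h' \<in> Hist_at M n" "undivided M n h h'"
    using that c7[THEN conjunct1] by blast
  show "Act_at M n \<subseteq> Act_at M n'" if "Rel_e M n n'"
    using that c8 by blast
qed

lemma Act_at_subset: "h \<in> Hist_at M n \<Longrightarrow> Act_at M n \<subseteq> Act M n h"
  by (auto simp: Act_at_def)

lemma sat_S4_Box: "S4_axiom Box A \<Longrightarrow> h \<in> Hist_at M m \<Longrightarrow> sat M m h A"
  by (erule S4_axiom.cases) auto

lemma sat_S4_Stit: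
  assumes "S4_axiom (Stit j) A" "j \<in> Ag" "h \<in> Hist_at M m"
  shows "sat M m h A"
  using assms(1)
proof cases
  case T
  then show ?thesis
    using cell_in_choice[OF model_frame assms(2,3)] by auto
next
  case (Four B)
  then show ?thesis
    using cell_eq[OF model_frame assms(2,3)] by auto
qed auto

lemma sat_S4_Know:
  assumes "S4_axiom Know A" "h \<in> Hist_at M m"
  shows "sat M m h A"
  using assms(1)
proof cases
  case (T B)
  then show ?thesis
    using Rel_refl[OF model_frame] assms(2) by simp blast
next
  case (Four B)
  then show ?thesis
    using Rel_trans[OF model_frame] by simp blast
qed auto

text \<open>Independence of agents: each premise \<open>\<diamond>[j]A\<close> selects a cell of \<open>j\<close>, the remaining agents take
  the cell of the current history, and a history common to all these cells witnesses the
  conclusion.\<close>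

lemma sat_A3:
  assumes h: "h \<in> Hist_at M m" and ps: "ps \<noteq> []" "distinct (map fst ps)" "fst ` set ps \<subseteq> Ag"
    and prem: "\<forall>(j, A)\<in>set ps. sat M m h (Dia (Stit j A))"
  shows "\<exists>g\<in>Hist_at M m. \<forall>(j, A)\<in>set ps. sat M m g (Stit j A)"
proof -
  have "\<exists>c\<in>choice M m j. \<forall>A. (j, A) \<in> set ps \<longrightarrow> (\<forall>g\<in>c. sat M m g A)" if j: "j \<in> Ag" for j
  proof (cases "\<exists>A. (j, A) \<in> set ps")
    case True
    then obtain A where A: "(j, A) \<in> set ps" ..
    then obtain g where "g \<in> Hist_at M m" "\<forall>g'\<in>cell M m j g. sat M m g' A"
      using prem by fastforce
    moreover have "B = A" if "(j, B) \<in> set ps" for B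
      using ps(2) A that by (metis eq_key_imp_eq_value)
    ultimately show ?thesis
      using cell_in_choice[OF model_frame j] by blast
  next
    case False
    then show ?thesis
      using cell_in_choice[OF model_frame j h] by blast
  qed
  then obtain f where f: "\<And>j. j \<in> Ag \<Longrightarrow> f j \<in> choice M m j"
    and fA: "\<And>j A g. j \<in> Ag \<Longrightarrow> (j, A) \<in> set ps \<Longrightarrow> g \<in> f j \<Longrightarrow> sat M m g A"
    by metis
  obtain g where g: "\<And>j. j \<in> Ag \<Longrightarrow> g \<in> f j"
    using choices_meet[OF model_frame f] by blast
  obtain j where "j \<in> Ag"
    using ps(1,3) by (cases ps) auto
  then have "g \<in> Hist_at M m"
    using f g partition_onD1[OF choice_partition[OF model_frame]] by blast
  moreover have "sat M m g (Stit j A)" if "(j, A) \<in> set ps" for j A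
  proof -
    have "j \<in> Ag"
      using that ps(3) by force
    then show ?thesis
      using fA[OF _ that] cell_eqI[OF model_frame _ f g] by simp
  qed
  ultimately show ?thesis
    by blast
qed

lemma sat_axiom:
  assumes "axiom_scheme A" "A \<in> Form Ag" and h: "h \<in> Hist_at M m"
  shows "sat M m h A"
  using assms(1,2)
proof cases
  case A0
  then show ?thesis
    using peval_sat[of M m h A] unfolding tautology_def by simp
next
  case A1_Box
  then show ?thesis
  proof cases
    case S4
    then show ?thesis
      using sat_S4_Box h by blast
  qed auto
next
  case (A1_Stit j)
  then show ?thesis
  proof cases
    case S4
    moreover have "j \<in> Ag"
      using assms(2) S4 by (auto simp: Form_def elim!: S4_axiom.cases)
    ultimately show ?thesis
      using sat_S4_Stit h by blast
  next
    case (Five B)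
    then have "j \<in> Ag"
      using assms(2) by (auto simp: Form_def)
    then show ?thesis
      using Five cell_eq[OF model_frame _ h] by auto
  qed
next
  case (A2 B j)
  then have "j \<in> Ag"
    using assms(2) by (auto simp: Form_def)
  then show ?thesis
    using A2 cell_subset[OF model_frame _ h] by auto
next
  case (A3 ps)
  have "fst ` set ps \<subseteq> Ag"
    using assms(2) A3(1) by (force simp: Form_def)
  then show ?thesis
    using sat_A3[OF h A3(2,3)] unfolding A3(1) by (simp add: split_beta) blast
next
  case (A4 s B C t)
  then show ?thesis
    using Evid_App by auto
next
  case (A5 t B)
  then show ?thesis
    using Evid_Check Evid_mono Rel_e_trans[OF model_frame] Rel_imp_Rel_e[OF model_frame] by simp blast
next
  case (A6 s B t)
  then show ?thesis
    using Evid_Sum[of m s t] by auto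
next
  case A7
  then show ?thesis
    using sat_S4_Know h by blast
next
  case (A8 B)
  then show ?thesis
    by auto
next
  case (A9 t)
  then show ?thesis
    using Act_at_mono Rel_imp_Rel_e[OF model_frame] by (simp add: Act_at_def) blast
qed

lemma sat_CS:
  assumes CS: "constant_specification Ag CS" "CS_normal CS M"
    and "A \<in> axioms Ag" "cs \<noteq> []" "const_prefix cs A \<in> CS" "h \<in> Hist_at M m"
  shows "sat M m h (const_prefix cs A)"
  using assms(4-6)
proof (induction cs arbitrary: m h)
  case (Cons c cs)
  have pre: "const_prefix (c # cs) A = Just (PConst c) (const_prefix cs A)"
    by (simp add: const_prefix_def)
  have "sat M n g (const_prefix cs A)" if "g \<in> Hist_at M n" for n g
  proof (cases "cs = []")
    case True
    then show ?thesis
      using sat_axiom that assms(3) by (simp add: axioms_def const_prefix_def)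
  next
    case False
    then have "const_prefix cs A \<in> CS"
      using CS(1) Cons.prems(2) assms(3) unfolding constant_specification_def by blast
    then show ?thesis
      using Cons.IH False that by blast
  qed
  moreover have "const_prefix cs A \<in> Evid M m (PConst c)"
    using CS(2) Cons.prems(2) unfolding CS_normal_def pre by blast
  ultimately show ?case
    by (simp add: pre)
qed simp

section \<open>Settled proofs and the rule \<open>R\<^sub>D\<close>\<close>

text \<open>A proof presented at \<open>n\<close> along \<open>h\<close> is presented along every history undivided from \<open>h\<close>,
  hence settled at each later moment of \<open>h\<close>.\<close>

lemma Act_imp_settled_later:
  assumes "t \<in> Act M n h" "lt M n n'" "h \<in> Hist_at M n'"
  shows "t \<in> Act_at M n'"
  unfolding Act_at_def
proof
  fix g
  assume g: "g \<in> Hist_at M n'"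
  have "h \<in> Hist_at M n" "g \<in> Hist_at M n"
    using assms g Hist_at_downward_closed[OF model_temporal] lt_imp_le[of M] by blast+
  moreover have "undivided M n h g"
    using assms g unfolding undivided_def by blast
  ultimately show "t \<in> Act M n' g"
    using Act_undivided Act_mono[OF assms(2) g] assms(1) by blast
qed

text \<open>A settled proof was presented strictly earlier; if the moment is an immediate successor of
  \<open>n\<close>, strictly earlier means no later than \<open>n\<close>.\<close>

lemma settled_Next_imp_Act:
  assumes "t \<in> Act_at M n'" "Next M n n'" "h \<in> Hist_at M n'"
  shows "t \<in> Act M n h"
proof -
  obtain k g where k: "lt M k n'" "g \<in> Hist_at M n'" "t \<in> Act M k g"
    using Act_at_earlier[OF assms(1)] by blast
  have nn': "lt M n n'" and "le M k n"
    using assms(2) k(1) unfolding Next_def by auto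
  have hg: "h \<in> Hist_at M n" "g \<in> Hist_at M n"
    using assms(3) k(2) nn' Hist_at_downward_closed[OF model_temporal] lt_imp_le[of M]
    by blast+
  have "t \<in> Act M n g"
    using k(3) \<open>le M k n\<close> Act_mono[OF _ hg(2)] unfolding lt_def by blast
  moreover have "undivided M n g h"
    using nn' assms(3) k(2) unfolding undivided_def by blast
  ultimately show ?thesis
    using Act_undivided hg by blast
qed

text \<open>The conditions on members of \<open>\<Theta>\<close> after the first one express how settledness spreads in
  every model on the frame: it persists along \<open>R\<^sub>e\<close>, is inherited
  from the immediate successors on all histories, and at a moment that is not an immediate
  successor it must already have occurred before. For the last point each proof of \<open>X\<close> has its own
  earlier moment, and finiteness allows the latest of these to be taken.\<close>

lemma settled_moments_in_Theta:
  assumes "finite X" "X \<noteq> {}" "X \<subseteq> Act_at M n"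
  shows "{k. X \<subseteq> Act_at M k} \<in> Theta M n"
proof -
  have "X \<subseteq> Act_at M k"
    if succ: "\<forall>h\<in>Hist_at M k. \<exists>k'\<in>h. Next M k k' \<and> X \<subseteq> Act_at M k'" for k
  proof
    fix t
    assume "t \<in> X"
    show "t \<in> Act_at M k"
      unfolding Act_at_def
    proof
      fix h
      assume h: "h \<in> Hist_at M k"
      then obtain k' where "k' \<in> h" "Next M k k'" "X \<subseteq> Act_at M k'"
        using succ by blast
      then show "t \<in> Act M k h"
        using settled_Next_imp_Act \<open>t \<in> X\<close> h by (auto simp: Hist_at_def)
    qed
  qed
  moreover have "\<exists>k'. lt M k' k \<and> X \<subseteq> Act_at M k'"
    if "X \<subseteq> Act_at M k" and dense: "\<forall>x. lt M x k \<longrightarrow> (\<exists>y. lt M x y \<and> lt M y k)" for k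
  proof -
    have single: "\<exists>k'. lt M k' k \<and> t \<in> Act_at M k'" if t: "t \<in> Act_at M k" for t
    proof -
      obtain x h where x: "lt M x k" "h \<in> Hist_at M k" "t \<in> Act M x h"
        using Act_at_earlier[OF t] by blast
      then obtain y where y: "lt M x y" "lt M y k"
        using dense by blast
      then have "h \<in> Hist_at M y"
        using x(2) Hist_at_downward_closed[OF model_temporal] lt_imp_le[of M] by blast
      then show ?thesis
        using Act_imp_settled_later[OF x(3) y(1)] y(2) by blast
    qed
    show ?thesis
      using assms(1,2) that(1)
    proof (induction rule: finite_ne_induct)
      case (singleton t)
      then show ?case
        using single by simp
    next
      case (insert t Y)
      then obtain u v where uv: "lt M u k" "t \<in> Act_at M u" "lt M v k" "Y \<subseteq> Act_at M v"
        using single by blast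
      \<comment> \<open>Both moments lie below \<open>k\<close>, so they are comparable and the later one serves.\<close>
      have "le M u v \<or> le M v u"
        using uv lt_imp_le[of M] le_linear_below[OF model_temporal] by blast
      then have "Act_at M u \<subseteq> Act_at M v \<or> Act_at M v \<subseteq> Act_at M u"
        using Act_at_mono le_imp_Rel[OF model_frame] Rel_imp_Rel_e[OF model_frame] by blast
      then show ?case
        using uv by blast
    qed
  qed
  moreover have "X \<subseteq> Act_at M k'" if "X \<subseteq> Act_at M k" "Rel_e M k k'" for k k'
    using that Act_at_mono by blast
  ultimately show ?thesis
    using assms(3) unfolding Theta_def mem_Collect_eq by blast
qed

text \<open>Settledness grows along \<open>h\<close>, so of finitely many proofs one of which is settled at each
  moment after \<open>n\<close>, some single one is settled at all of them.\<close>

lemma one_settled_at_all_later: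
  assumes "finite Y" and h: "h \<in> Hist M" and "x0 \<in> h" "lt M n x0"
    and some: "\<And>x. x \<in> h \<Longrightarrow> lt M n x \<Longrightarrow> \<exists>s\<in>Y. s \<in> Act_at M x"
  shows "\<exists>s\<in>Y. \<forall>x\<in>h. lt M n x \<longrightarrow> s \<in> Act_at M x"
proof (rule ccontr)
  assume none: "\<not> ?thesis"
  have "\<exists>x\<in>h. lt M n x \<and> (\<forall>s\<in>Y. s \<notin> Act_at M x)"
    using assms(1) none
  proof (induction Y)
    case empty
    then show ?case
      using assms(3,4) by blast
  next
    case (insert s Y)
    then obtain x where x: "x \<in> h" "lt M n x" "\<forall>s\<in>Y. s \<notin> Act_at M x"
      by auto
    obtain y where y: "y \<in> h" "lt M n y" "s \<notin> Act_at M y"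
      using insert.prems by blast
    have "le M x y \<or> le M y x"
      using history_comparable[OF model_temporal h] x y by blast
    then have "Act_at M x \<subseteq> Act_at M y \<or> Act_at M y \<subseteq> Act_at M x"
      using Act_at_mono le_imp_Rel[OF model_frame] Rel_imp_Rel_e[OF model_frame] by blast
    then show ?case
      using x y by blast
  qed
  then show False
    using some by blast
qed

text \<open>Suppose that all of \<open>ts\<close> and none of \<open>ss\<close> are presented at \<open>(m, h)\<close>. The premise at \<open>m\<close>
  yields a history \<open>g\<close> on which some \<open>t\<close> is missing, so \<open>g\<close> and
  \<open>h\<close> divide at \<open>m\<close>. After \<open>m\<close> all of \<open>ts\<close> are settled along \<open>h\<close>, so the premise there forces one
  single \<open>s\<close> to be settled throughout. Regularity, applied to the moments at which \<open>s\<close> and \<open>ts\<close> are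
  settled and to \<open>g\<close>, provides an immediate successor of \<open>m\<close> on \<open>h\<close>; but then \<open>s\<close> was presented at
  \<open>(m, h)\<close> already.\<close>

lemma R_D_sound:
  assumes reg: "regular M" and h: "h \<in> Hist_at M m"
    and prem: "\<And>n. Rel M m n \<Longrightarrow> set ts \<subseteq> Act_at M n \<Longrightarrow> \<exists>s\<in>set ss. s \<in> Act_at M n"
    and ts: "set ts \<subseteq> Act M m h"
  shows "\<exists>s\<in>set ss. s \<in> Act M m h"
proof (rule ccontr)
  assume ss: "\<not> ?thesis"
  have hH: "h \<in> Hist M" "m \<in> h"
    using h by (auto simp: Hist_at_def)
  have "\<not> set ts \<subseteq> Act_at M m"
    using prem[OF Rel_refl[OF model_frame]] ss Act_at_subset[OF h] by blast
  then obtain t g where t: "t \<in> set ts" "g \<in> Hist_at M m" "t \<notin> Act M m g"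
    by (auto simp: Act_at_def)
  have ndiv: "\<not> undivided M m h g"
    using Act_undivided[OF h t(2)] ts t(1,3) by blast
  have "g \<noteq> h"
    using t ts by blast
  have "\<exists>m1\<in>h. lt M m m1"
  proof (rule ccontr)
    assume "\<not> ?thesis"
    then have "le M x m" if "x \<in> h" for x
      using that history_comparable[OF model_temporal hH(1) that hH(2)]
      unfolding lt_def by blast
    then have "h \<subseteq> g"
      using Hist_at_downward_closed[OF model_temporal t(2)] by (auto simp: Hist_at_def)
    then show False
      using \<open>g \<noteq> h\<close> hH(1) t(2) unfolding Hist_at_def Hist_def pred_on.maxchain_def by blast
  qed
  then obtain m1 where m1: "m1 \<in> h" "lt M m m1"
    by blast
  have later: "set ts \<subseteq> Act_at M x" if "x \<in> h" "lt M m x" for x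
    using that ts hH(1) Act_imp_settled_later[of _ m h x] by (auto simp: Hist_at_def)
  have "\<exists>s\<in>set ss. s \<in> Act_at M x" if "x \<in> h" "lt M m x" for x
    using prem later[OF that] that(2) lt_imp_le[of M] le_imp_Rel[OF model_frame]
    by blast
  then obtain s where s: "s \<in> set ss" "\<And>x. x \<in> h \<Longrightarrow> lt M m x \<Longrightarrow> s \<in> Act_at M x"
    using one_settled_at_all_later[OF _ hH(1) m1, of "set ss"] by blast
  let ?X = "insert s (set ts)"
  let ?S = "{k. ?X \<subseteq> Act_at M k}"
  have S: "?S \<in> (\<Inter>m0\<in>{m0. lt M m m0 \<and> le M m0 m1}. Theta M m0)"
  proof
    fix m0
    assume "m0 \<in> {m0. lt M m m0 \<and> le M m0 m1}"
    then have "m0 \<in> h" "lt M m m0"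
      using history_downward_closed[OF model_temporal hH(1) m1(1)] by auto
    then show "?S \<in> Theta M m0"
      using settled_moments_in_Theta[of ?X] later s(2) by simp
  qed
  have mS: "m \<notin> ?S"
    using s(1) ss Act_at_subset[OF h] by blast
  have sep: "\<not> undivided M m g g'" if g': "g' \<in> Hist_at M m1" for g'
  proof
    assume "undivided M m g g'"
    then obtain y where "lt M m y" "le M y m1" "y \<in> g" "y \<in> g'"
      using undivided_share_moment[OF model_temporal, of m g' g m1] g' m1(2)
      unfolding undivided_def Hist_at_def by blast
    then show False
      using ndiv history_downward_closed[OF model_temporal hH(1) m1(1)] hH(1) t(2)
      unfolding undivided_def Hist_at_def by blast
  qed
  have succ: "k \<notin> ?S" if "k \<in> g" "Next M m k" for k
    using that settled_Next_imp_Act[of t k m g] t by (auto simp: Hist_at_def)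
  have "\<exists>m2. le M m2 m1 \<and> Next M m m2"
  proof (rule reg[unfolded regular_def, rule_format], intro conjI)
    have "\<exists>h'\<in>Hist_at M m. (\<forall>g\<in>Hist_at M m1. \<not> undivided M m h' g) \<and>
        (\<forall>k\<in>h'. Next M m k \<longrightarrow> k \<notin> ?S)"
      using sep succ t(2) by (intro bexI[of _ g]) simp_all
    then show "\<exists>S\<in>\<Inter>m0\<in>{m0. lt M m m0 \<and> le M m0 m1}. Theta M m0. m \<notin> S \<and>
        (\<exists>h'\<in>Hist_at M m. (\<forall>g\<in>Hist_at M m1. \<not> undivided M m h' g) \<and>
          (\<forall>k\<in>h'. Next M m k \<longrightarrow> k \<notin> S))"
      using mS by (intro bexI[OF _ S]) blast
  qed (rule m1(2))
  then obtain m2 where m2: "le M m2 m1" "Next M m m2"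
    by blast
  then have "m2 \<in> h" "lt M m m2"
    using history_downward_closed[OF model_temporal hH(1) m1(1)] unfolding Next_def by auto
  then have "s \<in> Act M m h"
    using settled_Next_imp_Act[OF s(2) m2(2)] hH(1) by (simp add: Hist_at_def)
  then show False
    using ss s(1) by blast
qed

lemma provable_sat:
  assumes reg: "regular M" and CS: "constant_specification Ag CS" "CS_normal CS M"
    and "provable Ag CS A" "h \<in> Hist_at M m"
  shows "sat M m h A"
  using assms(4,5)
proof (induction arbitrary: m h)
  case (Ax A)
  then show ?case
    using sat_axiom by (simp add: axioms_def)
next
  case (R1 A B)
  then show ?case
    by fastforce
next
  case (R2 A)
  then show ?case
    by simp
next
  case (R_D A ts ss)
  have "\<exists>s\<in>set ss. s \<in> Act M m h" if K: "sat M m h (Know A)" and ts: "set ts \<subseteq> Act M m h"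
  proof (rule R_D_sound[OF reg R_D.prems _ ts])
    fix n
    assume n: "Rel M m n" "set ts \<subseteq> Act_at M n"
    obtain g where g: "g \<in> Hist_at M n"
      using history_through_moment[OF model_temporal] by blast
    have "sat M n g (Know A)"
      using K n(1) Rel_trans[OF model_frame] by simp
    then show "\<exists>s\<in>set ss. s \<in> Act_at M n"
      using R_D.IH[OF g] n(2) by (fastforce simp: Act_at_def)
  qed
  then show ?case
    by (simp add: ball_Un subset_iff) blast
next
  case (R_CS A)
  then obtain cs B where "A = const_prefix cs B" "cs \<noteq> []" "B \<in> axioms Ag"
    using CS(1) unfolding constant_specification_def by blast
  then show ?case
    using sat_CS[OF CS] R_CS by blast
qed

end

section \<open>A countermodel on an irregular frame\<close>

text \<open>The proof variable \<open>1\<close> is to be settled exactly on \<open>S\<close>. A proof settled at an immediate successor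
  of \<open>n\<close> must be presented at \<open>n\<close> along the histories through that successor, whence the second
  disjunct.\<close>

definition proof1_presented ::
    "('m, 'ag, 'z) jstit_frame_scheme \<Rightarrow> 'm set \<Rightarrow> 'm \<Rightarrow> 'm set \<Rightarrow> bool" where
  "proof1_presented F S n g \<longleftrightarrow> n \<in> S \<or> (\<exists>k\<in>g. Next F n k \<and> k \<in> S)"

text \<open>The proof variable \<open>0\<close> is presented in addition at \<open>m\<close>, along those histories that are undivided
  at \<open>m\<close> from some history through \<open>m1\<close>; a common moment can be taken between \<open>m\<close> and \<open>m1\<close>.\<close>

definition proof0_presented ::
    "('m, 'ag, 'z) jstit_frame_scheme \<Rightarrow> 'm set \<Rightarrow> 'm \<Rightarrow> 'm \<Rightarrow> 'm \<Rightarrow> 'm set \<Rightarrow> bool" where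
  "proof0_presented F S m m1 n g \<longleftrightarrow>
     proof1_presented F S n g \<or> n = m \<and> (\<exists>x\<in>g. lt F m x \<and> le F x m1)"

definition countermodel ::
    "'ag set \<Rightarrow> ('m, 'ag) jstit_frame \<Rightarrow> 'm set \<Rightarrow> 'm \<Rightarrow> 'm \<Rightarrow> ('m, 'ag) jstit_model" where
  "countermodel Ag F S m m1 = jstit_frame.extend F (jstit_model.fields
     (\<lambda>n g. {t. t = PVar 1 \<and> proof1_presented F S n g \<or> t = PVar 0 \<and> proof0_presented F S m m1 n g})
     (\<lambda>n t. Form Ag) (\<lambda>p. {}))"

text \<open>All notions of a frame read the frame fields only, so a model and the frame that it is based
  on agree about them.\<close>

lemma truncate_invariant:
  shows "le (jstit_frame.truncate M) = le M"
    and "Rel (jstit_frame.truncate M) = Rel M"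
    and "choice (jstit_frame.truncate M) = choice M"
    and "Rel_e (jstit_frame.truncate M) = Rel_e M"
  by (simp_all add: jstit_frame.truncate_def)

lemma derived_truncate_invariant:
  shows "lt (jstit_frame.truncate M) = lt M"
    and "Hist_at (jstit_frame.truncate M) = Hist_at M"
    and "Next (jstit_frame.truncate M) = Next M"
    and "cell (jstit_frame.truncate M) = cell M"
    and "undivided (jstit_frame.truncate M) = undivided M"
    and "temporal_frame (jstit_frame.truncate M) = temporal_frame M"
    and "Theta (jstit_frame.truncate M) = Theta M"
  by (simp_all add: fun_eq_iff truncate_invariant lt_def Hist_at_def Hist_def Next_def cell_def
      undivided_def temporal_frame_def Theta_def)

lemma frame_property_truncate_invariant:
  shows "jstit_frame Ag (jstit_frame.truncate M) = jstit_frame Ag M"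
    and "regular (jstit_frame.truncate M) = regular M"
  by (simp_all add: truncate_invariant derived_truncate_invariant jstit_frame_def stit_frame_def
      regular_def)

lemma based_on_countermodel: "based_on (countermodel Ag F S m m1) F"
  by (simp add: based_on_def countermodel_def jstit_frame.defs jstit_model.defs)

lemma countermodel_simps:
  shows "Act (countermodel Ag F S m m1) n g =
      {t. t = PVar 1 \<and> proof1_presented F S n g \<or> t = PVar 0 \<and> proof0_presented F S m m1 n g}"
    and "Evid (countermodel Ag F S m m1) n t = Form Ag"
    and "Val (countermodel Ag F S m m1) p = {}"
  by (simp_all add: countermodel_def jstit_frame.defs jstit_model.defs)

lemma countermodel_frame:
  assumes "M = countermodel Ag F S m m1"
  shows "lt M = lt F" and "Hist_at M = Hist_at F" and "undivided M = undivided F"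
    and "Rel_e M = Rel_e F" and "jstit_frame Ag M = jstit_frame Ag F"
proof -
  have F: "F = jstit_frame.truncate M"
    using based_on_countermodel assms unfolding based_on_def by metis
  show "lt M = lt F" and "Hist_at M = Hist_at F" and "undivided M = undivided F"
    and "Rel_e M = Rel_e F" and "jstit_frame Ag M = jstit_frame Ag F"
    unfolding F truncate_invariant derived_truncate_invariant frame_property_truncate_invariant
    by (rule refl)+
qed

context
  fixes Ag :: "'ag set" and F :: "('m, 'ag) jstit_frame" and S m m1 h'
  assumes frame: "jstit_frame Ag F"
    and above: "lt F m m1"
    and Theta: "\<And>m0. lt F m m0 \<Longrightarrow> le F m0 m1 \<Longrightarrow> S \<in> Theta F m0"
    and mS: "m \<notin> S"
    and h': "h' \<in> Hist_at F m" "\<And>g. g \<in> Hist_at F m1 \<Longrightarrow> \<not> undivided F m h' g"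
      "\<And>k. k \<in> h' \<Longrightarrow> Next F m k \<Longrightarrow> k \<notin> S"
begin

lemma frame_temporal: "temporal_frame F"
  using jstit_frame_temporal[OF frame] .

lemma S_interval: "lt F m x \<Longrightarrow> le F x m1 \<Longrightarrow> x \<in> S"
  using Theta unfolding Theta_def by blast

lemma S_in_Theta: "S \<in> Theta F m1"
  using Theta[OF above le_refl[OF frame_temporal]] .

lemma S_Rel_e: "x \<in> S \<Longrightarrow> Rel_e F x y \<Longrightarrow> y \<in> S"
  using S_in_Theta unfolding Theta_def by blast

lemma S_le: "x \<in> S \<Longrightarrow> le F x y \<Longrightarrow> y \<in> S"
  using S_Rel_e le_imp_Rel[OF frame] Rel_imp_Rel_e[OF frame] by blast

text \<open>If \<open>n \<notin> S\<close>, each history through \<open>n\<close> has an immediate successor of \<open>n\<close> in \<open>S\<close>; the closure of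
  \<open>S\<close> under this situation puts \<open>n\<close> into \<open>S\<close>.\<close>

lemma proof1_settled_iff: "(\<forall>g\<in>Hist_at F n. proof1_presented F S n g) \<longleftrightarrow> n \<in> S"
  using S_in_Theta unfolding Theta_def proof1_presented_def by blast

text \<open>The additional occurrences of proof variable \<open>0\<close> do not change where it is settled, because it
  is absent at \<open>(m, h')\<close>.\<close>

lemma proof0_settled_iff: "(\<forall>g\<in>Hist_at F n. proof0_presented F S m m1 n g) \<longleftrightarrow> n \<in> S"
proof -
  have "\<not> proof0_presented F S m m1 m h'"
  proof
    assume "proof0_presented F S m m1 m h'"
    then obtain x where x: "x \<in> h'" "lt F m x" "le F x m1"
      using mS h'(3) unfolding proof0_presented_def proof1_presented_def by blast
    obtain g where g: "g \<in> Hist_at F m1"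
      using history_through_moment[OF frame_temporal] by blast
    then have "g \<in> Hist_at F x"
      using Hist_at_downward_closed[OF frame_temporal] x(3) by blast
    then show False
      using h'(1,2) g x unfolding undivided_def Hist_at_def by blast
  qed
  then have "n \<noteq> m \<or> \<not> (\<forall>g\<in>Hist_at F n. proof0_presented F S m m1 n g)"
    using h'(1) by blast
  then show ?thesis
    using proof1_settled_iff[of n] mS unfolding proof0_presented_def by blast
qed

lemma presented_imp_later_in_S:
  assumes "proof0_presented F S m m1 n g" "lt F n k" "g \<in> Hist_at F k"
  shows "k \<in> S"
proof -
  have g: "g \<in> Hist F" "k \<in> g"
    using assms(3) by (auto simp: Hist_at_def)
  consider "n \<in> S" | x where "x \<in> g" "Next F n x" "x \<in> S"
    | x where "n = m" "x \<in> g" "lt F m x" "le F x m1"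
    using assms(1) unfolding proof0_presented_def proof1_presented_def by blast
  then show ?thesis
  proof cases
    case 1
    then show ?thesis
      using S_le assms(2) lt_imp_le[of F] by blast
  next
    case (2 x)
    then show ?thesis
      using S_le Next_least_above[OF frame_temporal 2(2) g(1)] g(2) assms(2) by blast
  next
    case (3 x)
    then have "le F x k \<or> le F k x"
      using history_comparable[OF frame_temporal g(1)] g(2) by blast
    then show ?thesis
      using 3 S_interval S_le assms(2) le_trans[OF frame_temporal] by blast
  qed
qed

text \<open>If \<open>n\<close> is an immediate successor of some \<open>k\<close>, variable \<open>1\<close> is presented at \<open>k\<close> by virtue of
  \<open>n \<in> S\<close>; otherwise the last closure condition on \<open>S\<close> supplies an earlier moment of \<open>S\<close>.\<close>

lemma in_S_imp_presented_earlier: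
  assumes "n \<in> S"
  shows "\<exists>k. lt F k n \<and> (\<forall>g\<in>Hist_at F n. proof1_presented F S k g)"
proof (cases "\<forall>k. lt F k n \<longrightarrow> (\<exists>x. lt F k x \<and> lt F x n)")
  case True
  then show ?thesis
    using S_in_Theta assms unfolding Theta_def proof1_presented_def by blast
next
  case False
  then obtain k where k: "lt F k n" "\<And>x. lt F x n \<Longrightarrow> \<not> lt F k x"
    by blast
  then have "Next F k n"
    unfolding Next_def using le_linear_below[OF frame_temporal] lt_imp_le[of F] le_refl[OF frame_temporal]
    unfolding lt_def by metis
  then show ?thesis
    using k(1) assms unfolding proof1_presented_def Hist_at_def by blast
qed

lemma presented_undivided:
  assumes "undivided F n g g'"
  shows "proof1_presented F S n g \<Longrightarrow> proof1_presented F S n g'"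
    and "proof0_presented F S m m1 n g \<Longrightarrow> proof0_presented F S m m1 n g'"
proof -
  show one: "proof1_presented F S n g'" if "proof1_presented F S n g"
    using that Next_share[OF frame_temporal assms] unfolding proof1_presented_def by blast
  show "proof0_presented F S m m1 n g'" if "proof0_presented F S m m1 n g"
    using that one undivided_share_moment[OF frame_temporal assms] le_trans[OF frame_temporal]
    unfolding proof0_presented_def by blast
qed

lemma countermodel_is_model: "jstit_model Ag (countermodel Ag F S m m1)"
proof -
  define M where "M = countermodel Ag F S m m1"
  note [simp] = countermodel_simps[of Ag F S m m1, folded M_def] countermodel_frame[OF M_def]
  have Act_at: "Act_at M n = (if n \<in> S then {PVar 0, PVar 1} else {})" for n
    using proof1_settled_iff[of n] proof0_settled_iff[of n] history_through_moment[OF frame_temporal, of n]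
    unfolding Act_at_def by auto
  have imp: "proof1_presented F S n g \<Longrightarrow> proof0_presented F S m m1 n g" for n g
    by (simp add: proof0_presented_def)
  have in_S: "proof1_presented F S n g" "proof0_presented F S m m1 n g" if "n \<in> S" for n g
    using that by (simp_all add: proof0_presented_def proof1_presented_def)
  have "\<forall>n n'. lt M n n' \<longrightarrow> (\<forall>h\<in>Hist_at M n'. Act M n h \<subseteq> Act M n' h)"
  proof (intro allI impI ballI subsetI)
    fix n n' h t
    assume n': "lt M n n'" "h \<in> Hist_at M n'" and t: "t \<in> Act M n h"
    have "proof0_presented F S m m1 n h" "t = PVar 0 \<or> t = PVar 1"
      using t imp by auto
    moreover have "n' \<in> S"
      using presented_imp_later_in_S[OF calculation(1)] n' by simp
    ultimately show "t \<in> Act M n' h"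
      using in_S by auto
  qed
  moreover have "\<forall>n. Act_at M n \<subseteq> (\<Union>k\<in>{k. lt M k n}. \<Union>h\<in>Hist_at M n. Act M k h)"
  proof
    fix n
    show "Act_at M n \<subseteq> (\<Union>k\<in>{k. lt M k n}. \<Union>h\<in>Hist_at M n. Act M k h)"
    proof (cases "n \<in> S")
      case True
      then obtain k g where "lt F k n" "g \<in> Hist_at F n" "proof1_presented F S k g"
        using in_S_imp_presented_earlier history_through_moment[OF frame_temporal] by blast
      then show ?thesis
        using imp by (auto simp: Act_at)
    qed (simp add: Act_at)
  qed
  moreover have "\<forall>n. \<forall>h\<in>Hist_at M n. \<forall>g\<in>Hist_at M n. undivided M n h g \<longrightarrow> Act M n h = Act M n g"
  proof (intro allI ballI impI)
    fix n h g
    assume "undivided M n h g"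
    then have "undivided F n h g" "undivided F n g h"
      by (auto simp: undivided_def)
    then show "Act M n h = Act M n g"
      using presented_undivided[of n h g] presented_undivided[of n g h] by auto
  qed
  moreover have "\<forall>n n'. Rel_e M n n' \<longrightarrow> Act_at M n \<subseteq> Act_at M n'"
    using S_Rel_e by (simp add: Act_at)
  ultimately show ?thesis
    using frame unfolding jstit_model_def M_def[symmetric] by (auto simp: Form_def)
qed

end

text \<open>With \<open>A\<close> the premise itself, \<open>KA \<rightarrow> A\<close> is an axiom, so \<open>R\<^sub>D\<close> applies whatever the constant
  specification: once it is known that variable \<open>0\<close> is settled only together with variable \<open>1\<close>,
  variable \<open>0\<close> cannot be presented alone.\<close>

lemma provable_settled_to_presented:
  defines "A \<equiv> Or (Neg (Box (Ev (PVar 0)))) (Box (Ev (PVar 1)))"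
  shows "provable Ag CS (Imp (Know A) (Or (Neg (Ev (PVar 0))) (Ev (PVar 1))))"
proof -
  have "provable Ag CS (Imp (Know A)
      (big_or (map (\<lambda>t. Neg (Box (Ev t))) [PVar 0] @ map (\<lambda>s. Box (Ev s)) [PVar 1])))"
    unfolding A_def
    by (rule Ax) (simp add: axioms_def Form_def axiom_scheme.A7 S4_axiom.T)
  from R_D[OF this] show ?thesis
    by simp
qed

lemma sound_imp_regular:
  fixes F :: "('m, 'ag) jstit_frame"
  assumes frame: "jstit_frame Ag F" and CS: "constant_specification Ag CS"
    and sound: "\<And>(M :: ('m, 'ag) jstit_model) A. jstit_model Ag M \<Longrightarrow> based_on M F \<Longrightarrow>
      CS_normal CS M \<Longrightarrow> A \<in> Form Ag \<Longrightarrow> provable Ag CS A \<Longrightarrow> valid_in M A"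
  shows "regular F"
  unfolding regular_def
proof (intro allI impI, elim conjE bexE)
  fix m m1 S h'
  assume above: "lt F m m1" and S: "S \<in> (\<Inter>m0\<in>{m0. lt F m m0 \<and> le F m0 m1}. Theta F m0)"
    and mS: "m \<notin> S" and h': "h' \<in> Hist_at F m" "\<forall>g\<in>Hist_at F m1. \<not> undivided F m h' g"
      "\<forall>k\<in>h'. Next F m k \<longrightarrow> k \<notin> S"
  have T: "temporal_frame F"
    using jstit_frame_temporal[OF frame] .
  note irregular = frame above _ mS h'(1)
  have S': "S \<in> Theta F m0" if "lt F m m0" "le F m0 m1" for m0
    using S that by blast
  define M where "M = countermodel Ag F S m m1"
  note [simp] = countermodel_simps[of Ag F S m m1, folded M_def] countermodel_frame[OF M_def]
  let ?A = "Or (Neg (Box (Ev (PVar 0)))) (Box (Ev (PVar 1)))"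
  have "jstit_model Ag M"
    unfolding M_def using countermodel_is_model[OF irregular] S' h'(2,3) by blast
  moreover have "CS_normal CS M"
    using CS_subset_Form[OF CS] by (fastforce simp: CS_normal_def Form_def)
  ultimately have valid: "valid_in M (Imp (Know ?A) (Or (Neg (Ev (PVar 0))) (Ev (PVar 1))))"
    using sound based_on_countermodel[of Ag F S m m1, folded M_def]
      provable_settled_to_presented[of Ag CS] by (simp add: Form_def)
  obtain h where h: "h \<in> Hist_at F m1"
    using history_through_moment[OF T] by blast
  have hm: "h \<in> Hist_at F m"
    using Hist_at_downward_closed[OF T h] lt_imp_le[OF above] .
  have settled: "(\<forall>g\<in>Hist_at F n. proof0_presented F S m m1 n g) \<longleftrightarrow>
      (\<forall>g\<in>Hist_at F n. proof1_presented F S n g)" for n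
    using proof0_settled_iff[OF irregular, of n] proof1_settled_iff[OF irregular, of n] S' h'(2,3)
    by blast
  have "sat M m h (Know ?A)"
    using settled by auto
  moreover have "sat M m h (Imp (Know ?A) (Or (Neg (Ev (PVar 0))) (Ev (PVar 1))))"
    using valid hm unfolding valid_in_def MH_def by simp
  ultimately have "sat M m h (Or (Neg (Ev (PVar 0))) (Ev (PVar 1)))"
    by (simp only: sat.simps(2,3)) blast
  moreover have "PVar 0 \<in> Act M m h"
    using h above le_refl[OF T] by (auto simp: proof0_presented_def Hist_at_def)
  ultimately have "PVar 1 \<in> Act M m h"
    by simp
  then obtain k where "k \<in> h" "Next F m k"
    using mS by (auto simp: proof1_presented_def)
  then show "\<exists>m2. le F m2 m1 \<and> Next F m m2"
    using Next_least_above[OF T _ _ _ _ above] h by (auto simp: Hist_at_def)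
qed

theorem theorem6:
  fixes Ag :: "'ag set"
    and F :: "('m, 'ag) jstit_frame"
    and CS :: "'ag form set"
  assumes "finite Ag"
    and "jstit_frame Ag F"
    and "constant_specification Ag CS"
  shows "(\<forall>M :: ('m, 'ag) jstit_model.
            jstit_model Ag M \<and> based_on M F \<and> CS_normal CS M \<longrightarrow>
              (\<forall>A \<in> Form Ag. provable Ag CS A \<longrightarrow> valid_in M A))
         \<longleftrightarrow> F \<in> regular_frames Ag"
proof
  assume "\<forall>M :: ('m, 'ag) jstit_model.
            jstit_model Ag M \<and> based_on M F \<and> CS_normal CS M \<longrightarrow>
              (\<forall>A \<in> Form Ag. provable Ag CS A \<longrightarrow> valid_in M A)"
  then show "F \<in> regular_frames Ag"
    using sound_imp_regular[OF assms(2,3)] assms(2) unfolding regular_frames_def by blast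
next
  assume "F \<in> regular_frames Ag"
  then have reg: "regular M" if "based_on M F" for M :: "('m, 'ag) jstit_model"
    using that frame_property_truncate_invariant(2)[of M]
    unfolding based_on_def regular_frames_def by simp
  show "\<forall>M :: ('m, 'ag) jstit_model.
            jstit_model Ag M \<and> based_on M F \<and> CS_normal CS M \<longrightarrow>
              (\<forall>A \<in> Form Ag. provable Ag CS A \<longrightarrow> valid_in M A)"
  proof (intro allI impI ballI, elim conjE)
    fix M :: "('m, 'ag) jstit_model" and A
    assume M: "jstit_model Ag M" "based_on M F" "CS_normal CS M" and "provable Ag CS A"
    then show "valid_in M A"
      using provable_sat[OF M(1) reg[OF M(2)] assms(3) M(3)] unfolding valid_in_def MH_def by simp
  qed
qed

end
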